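(* Let $A$ be a finite set, $(M,\cdot)$ a commutative monoid, $k\in\mathbb{N}$, and $w:A^k\to M$ a weight map. Suppose there is $a\in A^k$ such that $w(a)$ is cancellative in $M$ (i.e. $w(a)x=w(a)y$ implies $x=y$). Then $\mathrm{Pol}(w)$ is borrow closed.
   Context: $B_n(A)=\mathrm{Sym}(A^n)$, $B(A)=\bigcup_n B_n(A)$; $i_1$ is the identity of $A$; for $f\in B_n(A)$, $g\in B_m(A)$, $f\oplus g\in B_{n+m}(A)$ applies $f$ to the first $n$ coordinates and $g$ to the last $m$. For a $k\times n$ array $a$ over $A$ and $f\in B_n(A)$, $f(a)$ denotes the array obtained by applying $f$ to each row of $a$, and $w(a)=\prod_{i=1}^n w(\text{$i$-th column of }a)$. $f\in B_n(A)$ respects $w$ if $w(a)=w(f(a))$ for every $k\times n$ array $a$ over $A$; $\mathrm{Pol}(w)$ is the set of all $f\in B(A)$ respecting $w$. A set $C\subseteq B(A)$ is borrow closed if for all $f\in B(A)$, $f\oplus i_1\in C$ implies $f\in C$. *)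

theory Defs
  imports "HOL-Algebra.Group" "HOL-Algebra.FiniteProduct" "HOL-Combinatorics.Permutations"
begin

definition tuples :: "'a set \<Rightarrow> nat \<Rightarrow> 'a list set" where
  "tuples A n = {xs. length xs = n \<and> set xs \<subseteq> A}"

text \<open>
  A permutation of \<open>A\<^sup>n\<close> is a function on lists that is the identity outside \<open>A\<^sup>n\<close>. Its arity
  cannot be read off such a function (e.g. the identities of all arities coincide), so an
  element of \<open>B(A)\<close> carries its arity as first component.
\<close>

definition B :: "'a set \<Rightarrow> (nat \<times> ('a list \<Rightarrow> 'a list)) set" where
  "B A = (\<Union>n. {n} \<times> {f. f permutes tuples A n})"

definition oplus ::
    "'a set \<Rightarrow> nat \<times> ('a list \<Rightarrow> 'a list) \<Rightarrow> nat \<times> ('a list \<Rightarrow> 'a list)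
      \<Rightarrow> nat \<times> ('a list \<Rightarrow> 'a list)" where
  "oplus A F G =
    (fst F + fst G,
     \<lambda>xs. if xs \<in> tuples A (fst F + fst G)
          then snd F (take (fst F) xs) @ snd G (drop (fst F) xs) else xs)"

definition i1 :: "nat \<times> ('a list \<Rightarrow> 'a list)" where
  "i1 = (1, id)"

text \<open>
  A \<open>k \<times> n\<close> array is the list of its \<open>k\<close> rows. Since \<open>n\<close> is not determined by the list when
  \<open>k = 0\<close>, it is passed explicitly where needed.
\<close>

definition arrays :: "'a set \<Rightarrow> nat \<Rightarrow> nat \<Rightarrow> 'a list list set" where
  "arrays A k n = {a. length a = k \<and> set a \<subseteq> tuples A n}"

definition column :: "'a list list \<Rightarrow> nat \<Rightarrow> 'a list" where
  "column a j = map (\<lambda>r. r ! j) a"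

definition array_weight ::
    "('m, 'x) monoid_scheme \<Rightarrow> ('a list \<Rightarrow> 'm) \<Rightarrow> nat \<Rightarrow> 'a list list \<Rightarrow> 'm" where
  "array_weight M w n a = finprod M (\<lambda>j. w (column a j)) {..<n}"

definition respects_weight ::
    "'a set \<Rightarrow> nat \<Rightarrow> ('m, 'x) monoid_scheme \<Rightarrow> ('a list \<Rightarrow> 'm)
      \<Rightarrow> nat \<times> ('a list \<Rightarrow> 'a list) \<Rightarrow> bool" where
  "respects_weight A k M w F \<longleftrightarrow>
    (\<forall>a \<in> arrays A k (fst F).
      array_weight M w (fst F) a = array_weight M w (fst F) (map (snd F) a))"

definition Pol ::
    "'a set \<Rightarrow> nat \<Rightarrow> ('m, 'x) monoid_scheme \<Rightarrow> ('a list \<Rightarrow> 'm)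
      \<Rightarrow> (nat \<times> ('a list \<Rightarrow> 'a list)) set" where
  "Pol A k M w = {F \<in> B A. respects_weight A k M w F}"

definition borrow_closed :: "'a set \<Rightarrow> (nat \<times> ('a list \<Rightarrow> 'a list)) set \<Rightarrow> bool" where
  "borrow_closed A C \<longleftrightarrow> C \<subseteq> B A \<and> (\<forall>F \<in> B A. oplus A F i1 \<in> C \<longrightarrow> F \<in> C)"

definition cancellative :: "('m, 'x) monoid_scheme \<Rightarrow> 'm \<Rightarrow> bool" where
  "cancellative M c \<longleftrightarrow>
    (\<forall>x \<in> carrier M. \<forall>y \<in> carrier M. c \<otimes>\<^bsub>M\<^esub> x = c \<otimes>\<^bsub>M\<^esub> y \<longrightarrow> x = y)"

end

theory Submission
  imports Defs
begin

text \<open>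
  Adjoin to an array \<open>a\<close> a last column \<open>c\<close> of cancellative weight. This multiplies the
  weights of \<open>a\<close> and of \<open>f(a)\<close> by \<open>w(c)\<close>, and \<open>f \<oplus> i\<^sub>1\<close> takes one extended array to the
  other; so if \<open>f \<oplus> i\<^sub>1\<close> respects \<open>w\<close>, then \<open>w(c)\<close> can be cancelled.
\<close>

definition append_column :: "'a list list \<Rightarrow> 'a list \<Rightarrow> 'a list list" where
  "append_column a c = map2 (\<lambda>r x. r @ [x]) a c"

lemma append_column_in_arrays:
  assumes "a \<in> arrays A k n" and "c \<in> tuples A k"
  shows "append_column a c \<in> arrays A k (Suc n)"
proof -
  have "r @ [x] \<in> tuples A (Suc n)" if "(r, x) \<in> set (zip a c)" for r x
    using assms set_zip_leftD[OF that] set_zip_rightD[OF that]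
    by (auto simp: arrays_def tuples_def)
  then have "set (append_column a c) \<subseteq> tuples A (Suc n)"
    by (auto simp: append_column_def)
  moreover have "length (append_column a c) = k"
    using assms by (simp add: arrays_def append_column_def tuples_def)
  ultimately show ?thesis
    by (simp add: arrays_def)
qed

text \<open>The map \<open>w\<close> is known to land in \<open>carrier M\<close> only on
  \<open>tuples A k\<close>; this is what makes every column weight a legitimate factor of a
  \<open>finprod\<close>.\<close>

lemma column_in_tuples:
  assumes "a \<in> arrays A k n" and "j < n"
  shows "column a j \<in> tuples A k"
  using assms by (auto simp: arrays_def column_def tuples_def subset_iff)

text \<open>Rows of \<open>a\<close> have length \<open>n\<close>, so the appended entry sits at
  position \<open>n\<close> and smaller positions still read the old row. The condition
  \<open>length c = k\<close> keeps \<open>map2\<close> from dropping rows.\<close>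

lemma column_append_column_less:
  assumes "a \<in> arrays A k n" and "length c = k" and "j < n"
  shows "column (append_column a c) j = column a j"
  using assms
  by (auto simp: arrays_def column_def append_column_def tuples_def nth_append
      subset_iff intro!: nth_equalityI)

lemma column_append_column_last:
  assumes "a \<in> arrays A k n" and "length c = k"
  shows "column (append_column a c) n = c"
  using assms
  by (auto simp: arrays_def column_def append_column_def tuples_def nth_append
      subset_iff intro!: nth_equalityI)

lemma map_in_arrays:
  assumes "a \<in> arrays A k n" and "f permutes tuples A n"
  shows "map f a \<in> arrays A k n"
  using assms by (auto simp: arrays_def subset_iff permutes_in_image)

text \<open>Needed for the cancellation at the end, because \<open>cancellative\<close> quantifies
  over elements of the carrier only.\<close>

lemma array_weight_closed:
  assumes "comm_monoid M" and "w \<in> tuples A k \<rightarrow> carrier M" and "a \<in> arrays A k n"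
  shows "array_weight M w n a \<in> carrier M"
  unfolding array_weight_def
  using assms column_in_tuples[OF assms(3)]
  by (intro comm_monoid.finprod_closed) auto

lemma array_weight_append_column:
  assumes "comm_monoid M" and w: "w \<in> tuples A k \<rightarrow> carrier M"
    and a: "a \<in> arrays A k n" and c: "c \<in> tuples A k"
  shows "array_weight M w (Suc n) (append_column a c) = w c \<otimes>\<^bsub>M\<^esub> array_weight M w n a"
proof -
  interpret comm_monoid M by fact
  have len: "length c = k"
    using c by (simp add: tuples_def)
  have col: "column a j \<in> tuples A k" if "j < n" for j
    using column_in_tuples[OF a that] .
  note less = column_append_column_less[OF a len]
    and last = column_append_column_last[OF a len]
  have "array_weight M w (Suc n) (append_column a c)
      = w c \<otimes>\<^bsub>M\<^esub> finprod M (\<lambda>j. w (column (append_column a c) j)) {..<n}"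
    unfolding array_weight_def lessThan_Suc
    \<comment> \<open>The inserted index \<open>n\<close> is that of the new column, so its factor
      is \<open>w c\<close>. The carrier conditions come from \<open>c\<close> and
      \<open>col\<close>.\<close>
    using w c col by (subst finprod_insert) (auto simp: less last)
  also have "finprod M (\<lambda>j. w (column (append_column a c) j)) {..<n} = array_weight M w n a"
    unfolding array_weight_def
    using w col by (intro finprod_cong') (auto simp: less)
  finally show ?thesis .
qed

text \<open>On an extended row \<open>r @ [x]\<close> with \<open>r\<close> of length
  \<open>n\<close>, the split at \<open>n\<close> in \<open>oplus\<close> recovers \<open>r\<close>
  and \<open>[x]\<close>; \<open>f\<close> acts on \<open>r\<close> and \<open>i1\<close> fixes
  \<open>[x]\<close>.\<close>

lemma map_oplus_i1_append_column:
  assumes "a \<in> arrays A k n" and "c \<in> tuples A k"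
  shows "map (snd (oplus A (n, f) i1)) (append_column a c) = append_column (map f a) c"
proof (rule nth_equalityI)
  show "length (map (snd (oplus A (n, f) i1)) (append_column a c))
      = length (append_column (map f a) c)"
    by (simp add: append_column_def)
next
  fix i assume "i < length (map (snd (oplus A (n, f) i1)) (append_column a c))"
  then have i: "i < length a" "i < length c"
    by (simp_all add: append_column_def)
  \<comment> \<open>Outside \<open>tuples A (n + 1)\<close> the function of \<open>oplus\<close>
    defaults to the identity, so the extended row has to be placed inside that set.\<close>
  then have "a ! i \<in> tuples A n" "c ! i \<in> A"
    using assms subsetD[OF _ nth_mem[OF i(1)], of "tuples A n"]
      subsetD[OF _ nth_mem[OF i(2)], of A]
    by (simp_all add: arrays_def tuples_def)
  with i show "map (snd (oplus A (n, f) i1)) (append_column a c) ! i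
      = append_column (map f a) c ! i"
    by (simp add: append_column_def oplus_def i1_def tuples_def)
qed

theorem theorem3:
  fixes A :: "'a set"
    and M :: "('m, 'x) monoid_scheme"
    and k :: nat
    and w :: "'a list \<Rightarrow> 'm"
  assumes "finite A"
    and "comm_monoid M"
    and "w \<in> tuples A k \<rightarrow> carrier M"
    and "\<exists>a \<in> tuples A k. cancellative M (w a)"
  shows "borrow_closed A (Pol A k M w)"
  unfolding borrow_closed_def
proof (intro conjI ballI impI)
  show "Pol A k M w \<subseteq> B A"
    by (auto simp: Pol_def)
next
  fix F assume F: "F \<in> B A" and "oplus A F i1 \<in> Pol A k M w"
  then have resp: "respects_weight A k M w (oplus A F i1)"
    by (simp add: Pol_def)
  obtain n f where F_eq: "F = (n, f)" and f: "f permutes tuples A n"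
    using F by (auto simp: B_def)
  obtain c where c: "c \<in> tuples A k" and canc: "cancellative M (w c)"
    using assms(4) by blast
  have "array_weight M w n a = array_weight M w n (map f a)" if a: "a \<in> arrays A k n" for a
  proof -
    have fa: "map f a \<in> arrays A k n"
      using map_in_arrays[OF a f] .
    \<comment> \<open>The first component sets the width of the arrays over which
      \<open>resp\<close> quantifies; with this value the extended array is an admissible
      instance.\<close>
    have arity: "fst (oplus A F i1) = Suc n"
      by (simp add: F_eq oplus_def i1_def)
    have "array_weight M w (Suc n) (append_column a c)
        = array_weight M w (Suc n) (append_column (map f a) c)"
      using bspec[OF resp[unfolded respects_weight_def arity] append_column_in_arrays[OF a c]]
      unfolding F_eq map_oplus_i1_append_column[OF a c] .
    then have "w c \<otimes>\<^bsub>M\<^esub> array_weight M w n a = w c \<otimes>\<^bsub>M\<^esub> array_weight M w n (map f a)"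
      by (simp add: array_weight_append_column[OF assms(2,3) _ c] a fa)
    with canc show ?thesis
      using array_weight_closed[OF assms(2,3)] a fa by (auto simp: cancellative_def)
  qed
  with F show "F \<in> Pol A k M w"
    by (simp add: Pol_def respects_weight_def F_eq)
qed

end
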